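(* Let $G$ be a simple connected graph of minimum degree at least $4$ and let $x$ be a vertex of $G$. Then $G$ contains an induced subgraph $H$ isomorphic to a subdivision of a wheel, or of the prism $K_2 \times K_3$, or of $K_{3,3}$, such that $G-V(H)$ is connected and contains $x$.
   Context: The wheel $W_\ell$ ($\ell \ge 3$) is obtained from a cycle of length $\ell$ by adding a new vertex adjacent to all vertices of the cycle; in particular $W_3 \cong K_4$. A subdivision of a graph $P$ is obtained by replacing edges of $P$ by internally disjoint paths. $K_2 \times K_3$ is the prism (two disjoint triangles joined by a perfect matching). *)

theory Defs
  imports "Graph_Theory.Graph_Theory"
begin

text \<open>
  Finite simple graphs are represented, as in \<^theory>\<open>Graph_Theory.Kuratowski\<close>, by their symmetric
  digraphs: every edge corresponds to two opposite arcs, and the degree of a vertex is its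
  \<^const>\<open>out_degree\<close>. Like \<^const>\<open>complete_bipartite_digraph\<close>, the predicates below are invariant
  under isomorphism.
\<close>

definition wheel :: "nat \<Rightarrow> ('a, 'b) pre_digraph \<Rightarrow> bool" where
  "wheel l G \<longleftrightarrow> 3 \<le> l \<and> graph G \<and>
    (\<exists>c h. inj_on c {..<l} \<and> h \<notin> c ` {..<l} \<and>
      verts G = insert h (c ` {..<l}) \<and>
      arcs_ends G = (\<Union>i<l. {(c i, c (Suc i mod l)), (c (Suc i mod l), c i), (h, c i), (c i, h)}))"

definition prism :: "('a, 'b) pre_digraph \<Rightarrow> bool" where
  "prism G \<longleftrightarrow> graph G \<and>
    (\<exists>a b. inj_on a {..<3::nat} \<and> inj_on b {..<3::nat} \<and> a ` {..<3} \<inter> b ` {..<3} = {} \<and>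
      verts G = a ` {..<3} \<union> b ` {..<3} \<and>
      arcs_ends G = {(a i, a j) | i j. i < 3 \<and> j < 3 \<and> i \<noteq> j} \<union>
                    {(b i, b j) | i j. i < 3 \<and> j < 3 \<and> i \<noteq> j} \<union>
                    (\<Union>i<3. {(a i, b i), (b i, a i)}))"

end

theory Submission
  imports Defs
begin

text \<open>
  Among the connected vertex sets \<open>A\<close> containing \<open>x\<close> for which \<open>G - A\<close> is not series-parallel,
  take a maximal one. In \<open>H = G - A\<close> a vertex with a neighbour in \<open>A\<close> is critical, that is, deleting
  it makes \<open>H\<close> series-parallel; every other vertex still has degree at least 4. A critical vertex
  of degree at most 2 has two nonadjacent neighbours and can be suppressed, which leaves a graph
  of minimum degree at least 3 whose cubic vertices are critical.

  A series-parallel graph has, outside any vertex or edge, a vertex of degree at most 2. Delete a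
  cubic vertex \<open>s\<close>, eliminate some of its neighbours and look at such a vertex \<open>y\<close>: either \<open>y\<close> is
  a cubic neighbour of \<open>s\<close>, or its degree dropped when some \<open>b\<close> was eliminated, and then \<open>y\<close> is
  adjacent to all neighbours of \<open>b\<close>. This determines the graph. If two cubic vertices lie in a
  triangle with a vertex of larger degree, this vertex is the hub of a wheel; a triangle of cubic
  vertices gives a prism or the complete graph on four vertices; and if no cubic vertex lies in a
  triangle, then all vertices are cubic and any two neighbours of a vertex have the same
  neighbours, which gives \<open>K\<^sub>3\<^sub>,\<^sub>3\<close>.
\<close>

section \<open>Connectedness in symmetric digraphs\<close>

lemma (in sym_digraph) connected_iff_closed:
  "Digraph_Component.connected G \<longleftrightarrow>
    verts G \<noteq> {} \<and> (\<forall>Z\<subseteq>verts G. Z \<noteq> {} \<longrightarrow> arcs_ends G `` Z \<subseteq> Z \<longrightarrow> Z = verts G)"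
proof
  assume "Digraph_Component.connected G"
  then have sc: "strongly_connected G"
    using sym_arcs by (intro symmetric_connected_imp_strongly_connected)
  have "Z = verts G" if Z: "Z \<subseteq> verts G" "Z \<noteq> {}" "arcs_ends G `` Z \<subseteq> Z" for Z
  proof -
    obtain z where "z \<in> Z" using Z(2) by blast
    have "v \<in> Z" if "v \<in> verts G" for v
    proof -
      have "z \<rightarrow>\<^sup>*\<^bsub>G\<^esub> v" using sc \<open>z \<in> Z\<close> Z(1) that by (auto simp: strongly_connected_def)
      then show ?thesis using \<open>z \<in> Z\<close> Z(3) by (induction rule: reachable_induct) auto
    qed
    then show ?thesis using Z(1) by blast
  qed
  then show "verts G \<noteq> {} \<and> (\<forall>Z\<subseteq>verts G. Z \<noteq> {} \<longrightarrow> arcs_ends G `` Z \<subseteq> Z \<longrightarrow> Z = verts G)"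
    using sc by (auto simp: strongly_connected_def)
next
  assume closed: "verts G \<noteq> {} \<and>
    (\<forall>Z\<subseteq>verts G. Z \<noteq> {} \<longrightarrow> arcs_ends G `` Z \<subseteq> Z \<longrightarrow> Z = verts G)"
  have "u \<rightarrow>\<^sup>*\<^bsub>G\<^esub> v" if "u \<in> verts G" "v \<in> verts G" for u v
  proof -
    have "{w. u \<rightarrow>\<^sup>*\<^bsub>G\<^esub> w} = verts G"
    proof (rule closed[THEN conjunct2, rule_format])
      show "{w. u \<rightarrow>\<^sup>*\<^bsub>G\<^esub> w} \<subseteq> verts G" by (auto intro: reachable_in_verts)
      show "{w. u \<rightarrow>\<^sup>*\<^bsub>G\<^esub> w} \<noteq> {}" using that(1) by auto
      show "arcs_ends G `` {w. u \<rightarrow>\<^sup>*\<^bsub>G\<^esub> w} \<subseteq> {w. u \<rightarrow>\<^sup>*\<^bsub>G\<^esub> w}" by (auto intro: reachable_adj_trans)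
    qed
    then show ?thesis using that(2) by blast
  qed
  then show "Digraph_Component.connected G"
    using closed by (intro connectedI) (auto simp: reachable_mk_symmetric_eq sym_arcs)
qed

lemma (in sym_digraph) connected_induce_iff_closed:
  assumes "A \<subseteq> verts G"
  shows "Digraph_Component.connected (G \<restriction> A) \<longleftrightarrow>
    A \<noteq> {} \<and> (\<forall>Z\<subseteq>A. Z \<noteq> {} \<longrightarrow> arcs_ends G `` Z \<inter> A \<subseteq> Z \<longrightarrow> Z = A)"
proof -
  interpret GA: sym_digraph "G \<restriction> A" using assms by (intro induced_graph_imp_graph induced_induce)
  have "arcs_ends (G \<restriction> A) `` Z = arcs_ends G `` Z \<inter> A" if "Z \<subseteq> A" for Z
    using that by (auto simp: arcs_ends_conv)
  then show ?thesis by (simp add: GA.connected_iff_closed cong: conj_cong)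
qed

lemma (in sym_digraph) connected_induce_insert:
  assumes "A \<subseteq> verts G" "Digraph_Component.connected (G \<restriction> A)" "u \<in> A" "u \<rightarrow>\<^bsub>G\<^esub> s"
  shows "Digraph_Component.connected (G \<restriction> insert s A)"
proof -
  have "Z = insert s A"
    if Z: "Z \<subseteq> insert s A" "Z \<noteq> {}" "arcs_ends G `` Z \<inter> insert s A \<subseteq> Z" for Z
  proof -
    have "s \<rightarrow>\<^bsub>G\<^esub> u" using assms(4) sym_arcs by (auto simp: symmetric_def dest: symD)
    then have "Z \<inter> A \<noteq> {}" using assms(3) Z by blast
    moreover have "arcs_ends G `` (Z \<inter> A) \<inter> A \<subseteq> Z \<inter> A" using Z(3) by blast
    ultimately have "A \<subseteq> Z"
      using assms(2) unfolding connected_induce_iff_closed[OF assms(1)] by blast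
    moreover have "s \<in> Z" using Z(3) \<open>A \<subseteq> Z\<close> assms(3,4) by blast
    ultimately show ?thesis using Z(1) by blast
  qed
  moreover have "insert s A \<subseteq> verts G" using assms(1,4) by (auto dest: adj_in_verts)
  ultimately show ?thesis by (simp add: connected_induce_iff_closed)
qed

section \<open>Deleting and eliminating vertices\<close>

abbreviation nbrs :: "'a pair_pre_digraph \<Rightarrow> 'a \<Rightarrow> 'a set" where
  "nbrs G v \<equiv> parcs G `` {v}"

abbreviation closed_nbrs :: "'a pair_pre_digraph \<Rightarrow> 'a \<Rightarrow> 'a set" where
  "closed_nbrs G v \<equiv> insert v (nbrs G v)"

abbreviation degree :: "'a pair_pre_digraph \<Rightarrow> 'a \<Rightarrow> nat" where
  "degree G v \<equiv> card (nbrs G v)"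

lemma out_degree_with_proj: "out_degree (with_proj G) v = degree G v"
proof -
  have "out_arcs (with_proj G) v = Pair v ` nbrs G v" by (auto simp: out_arcs_def)
  then show ?thesis by (simp add: out_degree_def card_image inj_on_def)
qed

definition delete_verts :: "'a pair_pre_digraph \<Rightarrow> 'a set \<Rightarrow> 'a pair_pre_digraph"
    (infixl \<open>\<ominus>\<close> 70) where
  "G \<ominus> A = \<lparr>pverts = pverts G - A, parcs = {(x, y) \<in> parcs G. x \<notin> A \<and> y \<notin> A}\<rparr>"

definition eliminate_vert :: "'a pair_pre_digraph \<Rightarrow> 'a \<Rightarrow> 'a pair_pre_digraph"
    (infixl \<open>\<oslash>\<close> 70) where
  "G \<oslash> w = \<lparr>pverts = pverts G - {w},
    parcs = {(x, y). x \<noteq> w \<and> y \<noteq> w \<and> x \<noteq> y \<and>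
      ((x, y) \<in> parcs G \<or> (x, w) \<in> parcs G \<and> (w, y) \<in> parcs G)}\<rparr>"

lemma pverts_delete_verts [simp]: "pverts (G \<ominus> A) = pverts G - A"
  by (simp add: delete_verts_def)

lemma in_parcs_delete_verts [simp]:
  "(x, y) \<in> parcs (G \<ominus> A) \<longleftrightarrow> (x, y) \<in> parcs G \<and> x \<notin> A \<and> y \<notin> A"
  by (simp add: delete_verts_def)

lemma pverts_eliminate_vert [simp]: "pverts (G \<oslash> w) = pverts G - {w}"
  by (simp add: eliminate_vert_def)

lemma in_parcs_eliminate_vert [simp]:
  "(x, y) \<in> parcs (G \<oslash> w) \<longleftrightarrow>
    x \<noteq> w \<and> y \<noteq> w \<and> x \<noteq> y \<and> ((x, y) \<in> parcs G \<or> (x, w) \<in> parcs G \<and> (w, y) \<in> parcs G)"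
  by (simp add: eliminate_vert_def)

lemma pair_pre_digraph_eqI:
  fixes G H :: "'a pair_pre_digraph"
  assumes "pverts G = pverts H" "\<And>x y. (x, y) \<in> parcs G \<longleftrightarrow> (x, y) \<in> parcs H"
  shows "G = H"
  using assms by (intro pair_pre_digraph.equality) auto

lemma delete_delete_verts: "G \<ominus> A \<ominus> B = G \<ominus> (A \<union> B)"
  by (rule pair_pre_digraph_eqI) auto

lemma eliminate_delete_commute:
  assumes "w \<notin> A"
  shows "G \<ominus> A \<oslash> w = G \<oslash> w \<ominus> A"
  using assms by (intro pair_pre_digraph_eqI) auto

lemma Image_delete_verts: "parcs (G \<ominus> A) `` Y = parcs G `` (Y - A) - A"
  by auto

lemma nbrs_delete_verts: "v \<notin> A \<Longrightarrow> nbrs (G \<ominus> A) v = nbrs G v - A"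
  by auto

context pair_graph
begin

lemma parcs_commute: "(u, v) \<in> parcs G \<longleftrightarrow> (v, u) \<in> parcs G"
  using arcs_symmetric by blast

lemma loopfree: "(v, v) \<notin> parcs G"
  using no_loops' by blast

lemma nbrs_subset: "nbrs G v \<subseteq> pverts G"
  using in_arcsD2 by auto

lemma finite_nbrs [simp]: "finite (nbrs G v)"
  using nbrs_subset pair_finite_verts by (rule finite_subset)

lemma nbrs_eqI:
  assumes "A \<subseteq> nbrs G v" "degree G v \<le> card A"
  shows "nbrs G v = A"
  using card_seteq[OF finite_nbrs assms] by simp

lemma in_parcs_if_nbrs_eq:
  assumes "nbrs G v = A"
  shows "(v, y) \<in> parcs G \<longleftrightarrow> y \<in> A" "(y, v) \<in> parcs G \<longleftrightarrow> y \<in> A"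
  using assms parcs_commute by auto

lemma notin_if_nbrs_eq: "nbrs G v = A \<Longrightarrow> v \<notin> A"
  using loopfree by blast

lemma parcs_eq_Union: "parcs G = (\<Union>v\<in>pverts G. {v} \<times> nbrs G v)"
  using in_arcsD1 by auto

lemma pair_graph_delete_verts: "pair_graph (G \<ominus> A)"
proof
  show "finite (parcs (G \<ominus> A))"
    using pair_finite_arcs by (rule rev_finite_subset) auto
  show "symmetric (with_proj (G \<ominus> A))"
    using arcs_symmetric by (auto simp: symmetric_def intro: symI)
qed (use pair_finite_verts in_arcsD1 in_arcsD2 no_loops' in auto)

lemma pair_graph_eliminate_vert: "pair_graph (G \<oslash> w)"
proof
  show "finite (parcs (G \<oslash> w))"
    by (rule finite_subset[of _ "pverts G \<times> pverts G"])
      (use pair_finite_verts in_arcsD1 in_arcsD2 in auto)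
  show "symmetric (with_proj (G \<oslash> w))"
    using arcs_symmetric by (auto simp: symmetric_def intro!: symI)
qed (use pair_finite_verts in_arcsD1 in_arcsD2 in auto)

lemma with_proj_delete_verts: "with_proj (G \<ominus> A) = with_proj G \<restriction> (pverts G - A)"
  using in_arcsD1 in_arcsD2
  by (auto simp: with_proj_def induce_subgraph_def delete_verts_def)

lemma nbrs_eliminate_vert_if_not_adj:
  assumes "v \<noteq> w" "(w, v) \<notin> parcs G"
  shows "nbrs (G \<oslash> w) v = nbrs G v"
  using assms loopfree parcs_commute by auto

lemma degree_delete_vert:
  assumes "v \<noteq> s"
  shows "degree (G \<ominus> {s}) v = (if (s, v) \<in> parcs G then degree G v - 1 else degree G v)"
proof -
  have "s \<in> nbrs G v \<longleftrightarrow> (s, v) \<in> parcs G" using parcs_commute by blast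
  then show ?thesis using assms by (simp add: nbrs_delete_verts)
qed

lemma closed_nbrs_mono_if_degree_eliminate_less:
  assumes "v \<noteq> w" "degree (G \<oslash> w) v < degree G v"
  shows "closed_nbrs G w \<subseteq> closed_nbrs G v"
proof
  interpret Gw: pair_graph "G \<oslash> w" by (rule pair_graph_eliminate_vert)
  have wv: "(v, w) \<in> parcs G"
    using assms nbrs_eliminate_vert_if_not_adj[of v w] parcs_commute by fastforce
  fix z assume z: "z \<in> closed_nbrs G w"
  show "z \<in> closed_nbrs G v"
  proof (rule ccontr)
    assume "z \<notin> closed_nbrs G v"
    then have "insert z (nbrs G v - {w}) \<subseteq> nbrs (G \<oslash> w) v"
      using z wv assms(1) loopfree by auto
    then have "card (insert z (nbrs G v - {w})) \<le> degree (G \<oslash> w) v" by (intro card_mono) auto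
    moreover have "card (insert z (nbrs G v - {w})) = degree G v"
      using wv \<open>z \<notin> closed_nbrs G v\<close> card_Suc_Diff1[of "nbrs G v" w] by simp
    ultimately show False using assms(2) by simp
  qed
qed

end

section \<open>Series-parallel graphs\<close>

text \<open>
  Every maximal sequence of eliminations of vertices of degree at most 2 ends with the empty graph.
  Asking for all sequences instead of one makes confluence of the eliminations irrelevant.
\<close>

inductive series_parallel :: "'a pair_pre_digraph \<Rightarrow> bool" where
  eliminations: "\<lbrakk>pverts G \<noteq> {} \<Longrightarrow> \<exists>w\<in>pverts G. degree G w \<le> 2;
    \<And>w. w \<in> pverts G \<Longrightarrow> degree G w \<le> 2 \<Longrightarrow> series_parallel (G \<oslash> w)\<rbrakk> \<Longrightarrow> series_parallel G"

lemma series_parallel_low_degree: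
  "series_parallel G \<Longrightarrow> pverts G \<noteq> {} \<Longrightarrow> \<exists>w\<in>pverts G. degree G w \<le> 2"
  by (erule series_parallel.cases) blast

lemma series_parallel_eliminate:
  "series_parallel G \<Longrightarrow> w \<in> pverts G \<Longrightarrow> degree G w \<le> 2 \<Longrightarrow> series_parallel (G \<oslash> w)"
  by (erule series_parallel.cases) blast

lemma (in pair_graph) nbrs_of_low_degree_vertex:
  assumes "degree G w \<le> 2"
  obtains p q where "nbrs G w \<subseteq> {p, q}" "p = q \<or> (p, q) \<in> parcs (G \<oslash> w)"
proof (cases "degree G w = 2")
  case True
  then obtain p q where pq: "nbrs G w = {p, q}" "p \<noteq> q" by (auto simp: card_2_iff)
  then have "(p, q) \<in> parcs (G \<oslash> w)"
    using in_parcs_if_nbrs_eq[OF pq(1)] loopfree by auto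
  then show thesis using that[of p q] pq by blast
next
  case False
  then have "degree G w \<le> Suc 0" using assms by simp
  then have "\<forall>x\<in>nbrs G w. \<forall>y\<in>nbrs G w. x = y" by (simp only: card_le_Suc0_iff_eq[OF finite_nbrs])
  then obtain p where "nbrs G w \<subseteq> {p}" by blast
  then show thesis using that[of p p] by blast
qed

lemma (in pair_graph) eliminate_vert_attachment:
  assumes "degree G w \<le> 2" "w \<notin> Y" "u = v \<or> (u, v) \<in> parcs G" "parcs G `` Y \<subseteq> Y \<union> {u, v}"
  obtains p q where "p = q \<or> (p, q) \<in> parcs (G \<oslash> w)" "parcs G `` Y \<subseteq> Y \<union> {w, p, q}"
    "nbrs G w \<inter> Y \<subseteq> {p, q}"
proof (cases "w \<in> {u, v}")
  case True
  obtain p q where pq: "nbrs G w \<subseteq> {p, q}" "p = q \<or> (p, q) \<in> parcs (G \<oslash> w)"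
    using nbrs_of_low_degree_vertex[OF assms(1)] .
  have "{u, v} \<subseteq> closed_nbrs G w" using True assms(3) arcs_symmetric[of u v] by auto
  then have "{u, v} \<subseteq> {w, p, q}" using pq(1) by blast
  then have "parcs G `` Y \<subseteq> Y \<union> {w, p, q}" using assms(4) by blast
  then show thesis using that[of p q] pq by blast
next
  case False
  have "u = v \<or> (u, v) \<in> parcs (G \<oslash> w)" using False assms(3) loopfree by auto
  moreover have "w \<notin> parcs G `` Y" using False assms(2,4) by blast
  then have "nbrs G w \<inter> Y \<subseteq> {u, v}" using arcs_symmetric by blast
  ultimately show thesis using that[of u v] assms(4) by blast
qed

lemma series_parallel_attached_low_degree:
  assumes "series_parallel G" "pair_graph G"
    and "Y \<subseteq> pverts G" "Y \<noteq> {}" "u = v \<or> (u, v) \<in> parcs G" "u \<notin> Y" "v \<notin> Y"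
    and "parcs G `` Y \<subseteq> Y \<union> {u, v}"
  shows "\<exists>y\<in>Y. degree G y \<le> 2"
  using assms
proof (induction arbitrary: Y u v rule: series_parallel.induct)
  case (eliminations G)
  interpret pair_graph G by fact
  obtain w where w: "w \<in> pverts G" "degree G w \<le> 2"
    using eliminations.hyps eliminations.prems(2,3) by blast
  interpret Gw: pair_graph "G \<oslash> w" by (rule pair_graph_eliminate_vert)
  show ?case
  proof (cases "w \<in> Y")
    case True
    then show ?thesis using w(2) by blast
  next
    case False
    obtain p q where pq: "p = q \<or> (p, q) \<in> parcs (G \<oslash> w)" "parcs G `` Y \<subseteq> Y \<union> {w, p, q}"
      "nbrs G w \<inter> Y \<subseteq> {p, q}"
      using eliminate_vert_attachment[OF w(2) False eliminations.prems(4,7)] .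
    show ?thesis
    proof (cases "Y \<subseteq> {p, q}")
      case True
      obtain y where y: "y \<in> Y" "y \<in> {p, q}" using True eliminations.prems(3) by blast
      have "nbrs G y \<subseteq> {p, q, w}" using y(1) pq(2) True by blast
      then have "nbrs G y \<subseteq> {p, q, w} - {y}" using loopfree[of y] by auto
      then have "degree G y \<le> card ({p, q, w} - {y})" by (intro card_mono) auto
      also have "\<dots> \<le> 2" using y(2) by (auto simp: card_insert_if insert_Diff_if)
      finally show ?thesis using y(1) by blast
    next
      case False
      define Y' where "Y' = Y - {p, q}"
      have unchanged: "nbrs (G \<oslash> w) y = nbrs G y" if "y \<in> Y'" for y
        using that pq(3) \<open>w \<notin> Y\<close> by (intro nbrs_eliminate_vert_if_not_adj) (auto simp: Y'_def)
      have "w \<notin> parcs G `` Y'" using pq(3) arcs_symmetric by (fastforce simp: Y'_def)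
      then have "parcs G `` Y' \<subseteq> Y' \<union> {p, q}" using pq(2) unfolding Y'_def by blast
      then have closed: "parcs (G \<oslash> w) `` Y' \<subseteq> Y' \<union> {p, q}"
        by (simp add: Image_eq_UN[of _ Y'] unchanged)
      have "\<exists>y\<in>Y'. degree (G \<oslash> w) y \<le> 2"
        using False \<open>w \<notin> Y\<close> eliminations.prems(2)
        by (intro eliminations.IH[OF w Gw.pair_graph _ _ pq(1) _ _ closed]) (auto simp: Y'_def)
      then show ?thesis using unchanged by (auto simp: Y'_def)
    qed
  qed
qed

corollary series_parallel_low_degree_outside_edge:
  assumes "series_parallel G" "pair_graph G" "u = v \<or> (u, v) \<in> parcs G"
    and "\<not> pverts G \<subseteq> {u, v}"
  obtains y where "y \<in> pverts G" "y \<notin> {u, v}" "degree G y \<le> 2"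
proof -
  have "\<exists>y\<in>pverts G - {u, v}. degree G y \<le> 2"
    using assms(4) pair_graph.nbrs_subset[OF assms(2)]
    by (intro series_parallel_attached_low_degree[OF assms(1,2) _ _ assms(3)]) auto
  then show thesis using that by blast
qed

lemma (in pair_graph) degree_le_3_if_series_parallel_delete:
  assumes "series_parallel (G \<ominus> {s})" "\<not> pverts G \<subseteq> {s}"
  shows "\<exists>v\<in>pverts G - {s}. degree G v \<le> 3"
proof -
  obtain v where "v \<in> pverts G - {s}" "degree (G \<ominus> {s}) v \<le> 2"
    using series_parallel_low_degree[OF assms(1)] assms(2) by auto
  then show ?thesis by (intro bexI[of _ v]) (auto simp: degree_delete_vert split: if_splits)
qed

section \<open>Cycles, wheels, prisms and complete bipartite graphs\<close>

abbreviation (input) wheel_prism_or_K33 :: "'a pair_pre_digraph \<Rightarrow> bool" where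
  "wheel_prism_or_K33 P \<equiv> (\<exists>l. wheel l (with_proj P)) \<or> prism (with_proj P) \<or>
    complete_bipartite_digraph 3 3 (with_proj P)"

definition cycle_graph :: "nat \<Rightarrow> 'a pair_pre_digraph \<Rightarrow> bool" where
  "cycle_graph l G \<longleftrightarrow> 3 \<le> l \<and>
    (\<exists>c. inj_on c {..<l} \<and> pverts G = c ` {..<l} \<and>
      parcs G = (\<Union>i<l. {(c i, c (Suc i mod l)), (c (Suc i mod l), c i)}))"

definition vertex_path :: "'a pair_pre_digraph \<Rightarrow> (nat \<Rightarrow> 'a) \<Rightarrow> nat \<Rightarrow> bool" where
  "vertex_path G c m \<longleftrightarrow>
    c ` {..m} \<subseteq> pverts G \<and> inj_on c {..m} \<and> (\<forall>i<m. (c i, c (Suc i)) \<in> parcs G)"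

definition vertex_cycle :: "'a pair_pre_digraph \<Rightarrow> (nat \<Rightarrow> 'a) \<Rightarrow> nat \<Rightarrow> bool" where
  "vertex_cycle G c l \<longleftrightarrow> 3 \<le> l \<and>
    c ` {..<l} \<subseteq> pverts G \<and> inj_on c {..<l} \<and> (\<forall>i<l. (c i, c (Suc i mod l)) \<in> parcs G)"

context pair_graph
begin

lemma obtain_maximal_vertex_path:
  assumes "pverts G \<noteq> {}"
  obtains c m where "vertex_path G c m" "nbrs G (c m) \<subseteq> c ` {..m}"
proof -
  obtain v where "v \<in> pverts G" using assms by blast
  then have trivial: "\<exists>c. vertex_path G c 0"
    by (intro exI[of _ "\<lambda>_. v"]) (simp add: vertex_path_def)
  have bounded: "m \<le> card (pverts G)" if path: "\<exists>c. vertex_path G c m" for m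
  proof -
    obtain c where "inj_on c {..m}" "c ` {..m} \<subseteq> pverts G"
      using path by (auto simp: vertex_path_def)
    then have "card {..m} \<le> card (pverts G)" using pair_finite_verts by (rule card_inj_on_le)
    then show ?thesis by simp
  qed
  define m where "m = (GREATEST m. \<exists>c. vertex_path G c m)"
  have longest: "m' \<le> m" if "vertex_path G c m'" for c m'
    unfolding m_def
    using Greatest_le_nat[of "\<lambda>m. \<exists>c. vertex_path G c m", OF _ bounded] that by blast
  obtain c where c: "vertex_path G c m"
    unfolding m_def
    using GreatestI_nat[of "\<lambda>m. \<exists>c. vertex_path G c m", OF trivial bounded] by blast
  have "y \<in> c ` {..m}" if "(c m, y) \<in> parcs G" for y
  proof (rule ccontr)
    assume "y \<notin> c ` {..m}"
    then have "vertex_path G (c(Suc m := y)) (Suc m)"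
      using c that in_arcsD2[OF that]
      by (auto simp: vertex_path_def atMost_Suc less_Suc_eq inj_on_def)
    then show False using longest by fastforce
  qed
  then show thesis using that c by blast
qed

context
  assumes two_regular: "\<And>v. v \<in> pverts G \<Longrightarrow> degree G v = 2"
begin

lemma two_regular_nbrs_eq:
  assumes "(v, p) \<in> parcs G" "(v, q) \<in> parcs G" "p \<noteq> q"
  shows "nbrs G v = {p, q}"
  using assms two_regular[OF in_arcsD1[OF assms(1)]] by (intro nbrs_eqI) auto

lemma maximal_vertex_path_closes:
  assumes path: "vertex_path G c m" and maximal: "nbrs G (c m) \<subseteq> c ` {..m}"
  shows "2 \<le> m" "(c m, c 0) \<in> parcs G"
proof -
  have inj: "c i = c j \<longleftrightarrow> i = j" if "i \<le> m" "j \<le> m" for i j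
    using path that by (auto simp: vertex_path_def inj_on_eq_iff)
  have step: "(c i, c (Suc i)) \<in> parcs G" if "i < m" for i
    using path that by (simp add: vertex_path_def)
  have ends: "j = 0 \<or> Suc j = m" if j: "j \<le> m" "(c m, c j) \<in> parcs G" for j
  proof (cases j)
    case (Suc k)
    have "j < m" using j loopfree by (metis le_neq_implies_less)
    have "nbrs G (c j) = {c k, c (Suc j)}"
    proof (rule two_regular_nbrs_eq)
      show "(c j, c k) \<in> parcs G" using step[of k] \<open>j < m\<close> Suc arcs_symmetric by simp
      show "c k \<noteq> c (Suc j)" using inj \<open>j < m\<close> Suc by simp
    qed (rule step[OF \<open>j < m\<close>])
    then have "c m = c k \<or> c m = c (Suc j)" using arcs_symmetric[OF j(2)] by auto
    then show ?thesis using inj \<open>j < m\<close> Suc by auto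
  qed simp
  have nbrs: "nbrs G (c m) \<subseteq> {c 0, c (m - 1)}" using maximal ends by fastforce
  have degree: "degree G (c m) = 2" using two_regular[of "c m"] path by (auto simp: vertex_path_def)
  have neq: "c 0 \<noteq> c (m - 1)"
  proof
    assume "c 0 = c (m - 1)"
    then have "degree G (c m) \<le> card {c 0}" using nbrs by (intro card_mono) auto
    then show False using degree by simp
  qed
  then show "2 \<le> m" by (cases "m - 1") auto
  have "nbrs G (c m) = {c 0, c (m - 1)}" using nbrs degree neq by (intro card_seteq) auto
  then show "(c m, c 0) \<in> parcs G" by auto
qed

lemma obtain_vertex_cycle:
  assumes "pverts G \<noteq> {}"
  obtains c l where "vertex_cycle G c l"
proof -
  obtain c m where path: "vertex_path G c m" "nbrs G (c m) \<subseteq> c ` {..m}"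
    using obtain_maximal_vertex_path[OF assms] .
  note closes = maximal_vertex_path_closes[OF path]
  have "(c i, c (Suc i mod Suc m)) \<in> parcs G" if "i < Suc m" for i
    using path(1) closes(2) that by (cases "i = m") (auto simp: vertex_path_def)
  then have "vertex_cycle G c (Suc m)"
    using path(1) closes(1) by (simp add: vertex_path_def vertex_cycle_def lessThan_Suc_atMost)
  then show thesis by (rule that)
qed

lemma vertex_cycle_nbrs:
  assumes "vertex_cycle G c l" "i < l"
  obtains k where "k < l" "Suc k mod l = i" "nbrs G (c i) = {c k, c (Suc i mod l)}"
proof -
  have l: "3 \<le> l" and inj: "inj_on c {..<l}"
    and step: "\<And>j. j < l \<Longrightarrow> (c j, c (Suc j mod l)) \<in> parcs G"
    using assms(1) by (simp_all add: vertex_cycle_def)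
  define k where "k = (i + (l - 1)) mod l"
  have "Suc k mod l = (i + l) mod l" using l by (simp add: k_def mod_Suc_eq)
  then have k: "k < l" "Suc k mod l = i" using assms(2) by (simp_all add: k_def)
  have "k \<noteq> Suc i mod l" using k l by (auto simp: mod_Suc split: if_splits)
  then have "c k \<noteq> c (Suc i mod l)" using inj k(1) by (simp add: inj_on_eq_iff)
  moreover have "(c i, c k) \<in> parcs G" using step[OF k(1)] arcs_symmetric by (simp add: k(2))
  ultimately have "nbrs G (c i) = {c k, c (Suc i mod l)}"
    using step[OF assms(2)] by (intro two_regular_nbrs_eq)
  then show thesis using that k by blast
qed

lemma cycle_graph_if_connected:
  assumes "Digraph_Component.connected (with_proj G)"
  shows "\<exists>l. cycle_graph l G"
proof -
  have "pverts G \<noteq> {}" using assms unfolding connected_iff_closed by blast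
  then obtain c l where cycle: "vertex_cycle G c l" by (rule obtain_vertex_cycle)
  have verts: "pverts G = c ` {..<l}"
  proof -
    have "parcs G `` (c ` {..<l}) \<subseteq> c ` {..<l}"
    proof
      fix y assume "y \<in> parcs G `` (c ` {..<l})"
      then obtain i where i: "i < l" "y \<in> nbrs G (c i)" by auto
      obtain k where "k < l" "nbrs G (c i) = {c k, c (Suc i mod l)}"
        using vertex_cycle_nbrs[OF cycle i(1)] by blast
      then show "y \<in> c ` {..<l}" using i by auto
    qed
    moreover have "c ` {..<l} \<noteq> {}" "c ` {..<l} \<subseteq> pverts G"
      using cycle by (auto simp: vertex_cycle_def lessThan_empty_iff)
    ultimately show ?thesis using assms unfolding connected_iff_closed by blast
  qed
  have "parcs G = (\<Union>i<l. {(c i, c (Suc i mod l)), (c (Suc i mod l), c i)})"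
  proof (intro subset_antisym subrelI)
    fix x y assume xy: "(x, y) \<in> parcs G"
    then obtain i where i: "i < l" "x = c i" using in_arcsD1 verts by blast
    obtain k where k: "k < l" "Suc k mod l = i" "nbrs G (c i) = {c k, c (Suc i mod l)}"
      using vertex_cycle_nbrs[OF cycle i(1)] .
    have "y \<in> {c k, c (Suc i mod l)}" using xy i(2) k(3) by blast
    then show "(x, y) \<in> (\<Union>i<l. {(c i, c (Suc i mod l)), (c (Suc i mod l), c i)})"
      using i k(1,2) by blast
  qed (use cycle arcs_symmetric in \<open>auto simp: vertex_cycle_def\<close>)
  then show ?thesis using cycle verts unfolding cycle_graph_def vertex_cycle_def by blast
qed

end

lemma wheel_if_cycle_graph_delete_hub:
  assumes "h \<in> pverts G" "nbrs G h = pverts G - {h}" "cycle_graph l (G \<ominus> {h})"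
  shows "wheel l (with_proj G)"
proof -
  obtain c where c: "3 \<le> l" "inj_on c {..<l}" "pverts G - {h} = c ` {..<l}"
    "parcs (G \<ominus> {h}) = (\<Union>i<l. {(c i, c (Suc i mod l)), (c (Suc i mod l), c i)})"
    using assms(3) by (auto simp: cycle_graph_def)
  have "parcs G = parcs (G \<ominus> {h}) \<union> {h} \<times> nbrs G h \<union> nbrs G h \<times> {h}"
    using arcs_symmetric loopfree by auto
  also have "\<dots> = (\<Union>i<l. {(c i, c (Suc i mod l)), (c (Suc i mod l), c i), (h, c i), (c i, h)})"
    unfolding assms(2) c(3,4) by blast
  finally have arcs: "parcs G = \<dots>" .
  have "h \<notin> c ` {..<l}" "pverts G = insert h (c ` {..<l})" using c(3) assms(1) by blast+
  then show ?thesis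
    unfolding wheel_def with_proj_simps using c(1,2) arcs pair_graphD_graph by blast
qed

lemma prismI:
  fixes a b :: "nat \<Rightarrow> 'a"
  assumes inj: "inj_on a {..<3}" "inj_on b {..<3}" "a ` {..<3} \<inter> b ` {..<3} = {}"
    and verts: "pverts G = a ` {..<3} \<union> b ` {..<3}"
    and nbrs: "\<And>i. i < 3 \<Longrightarrow> nbrs G (a i) = insert (b i) (a ` ({..<3} - {i}))"
      "\<And>i. i < 3 \<Longrightarrow> nbrs G (b i) = insert (a i) (b ` ({..<3} - {i}))"
  shows "prism (with_proj G)"
proof -
  have "parcs G = (\<Union>i<3. {a i} \<times> nbrs G (a i)) \<union> (\<Union>i<3. {b i} \<times> nbrs G (b i))"
    by (subst parcs_eq_Union) (auto simp: verts)
  also have "\<dots> = {(a i, a j) | i j. i < 3 \<and> j < 3 \<and> i \<noteq> j} \<union>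
      {(b i, b j) | i j. i < 3 \<and> j < 3 \<and> i \<noteq> j} \<union> (\<Union>i<3. {(a i, b i), (b i, a i)})"
    by (auto simp: nbrs)
  finally show ?thesis
    unfolding prism_def with_proj_simps using inj verts pair_graphD_graph by blast
qed

lemma prism_if_nbrs_eq:
  assumes distinct: "distinct [a\<^sub>0, a\<^sub>1, a\<^sub>2, b\<^sub>0, b\<^sub>1, b\<^sub>2]"
    and verts: "pverts G = {a\<^sub>0, a\<^sub>1, a\<^sub>2, b\<^sub>0, b\<^sub>1, b\<^sub>2}"
    and nbrs_a: "nbrs G a\<^sub>0 = {a\<^sub>1, a\<^sub>2, b\<^sub>0}" "nbrs G a\<^sub>1 = {a\<^sub>0, a\<^sub>2, b\<^sub>1}"
      "nbrs G a\<^sub>2 = {a\<^sub>0, a\<^sub>1, b\<^sub>2}"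
    and nbrs_b: "nbrs G b\<^sub>0 = {b\<^sub>1, b\<^sub>2, a\<^sub>0}" "nbrs G b\<^sub>1 = {b\<^sub>0, b\<^sub>2, a\<^sub>1}"
      "nbrs G b\<^sub>2 = {b\<^sub>0, b\<^sub>1, a\<^sub>2}"
  shows "prism (with_proj G)"
proof (rule prismI)
  let ?a = "(!) [a\<^sub>0, a\<^sub>1, a\<^sub>2]" and ?b = "(!) [b\<^sub>0, b\<^sub>1, b\<^sub>2]"
  have below_3: "{..<3} = {0, 1, 2::nat}" by auto
  show "inj_on ?a {..<3}" "inj_on ?b {..<3}" using distinct by (auto intro!: inj_on_nth)
  show "?a ` {..<3} \<inter> ?b ` {..<3} = {}" using distinct by (auto simp: below_3)
  show "pverts G = ?a ` {..<3} \<union> ?b ` {..<3}" unfolding verts by (auto simp: below_3)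
  fix i :: nat
  assume "i < 3"
  then consider "i = 0" | "i = 1" | "i = 2" by linarith
  then show "nbrs G (?a i) = insert (?b i) (?a ` ({..<3} - {i}))"
    "nbrs G (?b i) = insert (?a i) (?b ` ({..<3} - {i}))"
    by (cases; simp add: below_3 nbrs_a nbrs_b insert_Diff_if insert_commute)+
qed

lemma complete_bipartite_digraphI:
  assumes "pverts G = U \<union> W" "U \<inter> W = {}"
    and "\<And>u. u \<in> U \<Longrightarrow> nbrs G u = W" "\<And>w. w \<in> W \<Longrightarrow> nbrs G w = U"
  shows "complete_bipartite_digraph (card U) (card W) (with_proj G)"
proof -
  have "parcs G = U \<times> W \<union> W \<times> U"
    by (subst parcs_eq_Union) (auto simp: assms)
  then show ?thesis
    unfolding complete_bipartite_digraph_pair_def using assms(1,2) pair_finite_verts by blast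
qed

end

section \<open>Critical graphs\<close>

lemma card_3_obtain_third:
  assumes "card A = 3" "p \<in> A" "q \<in> A" "p \<noteq> q"
  obtains r where "A = {p, q, r}" "r \<noteq> p" "r \<noteq> q"
proof -
  have "card (A - {p, q}) = 1"
    using assms by (simp add: card_Diff_subset)
  then obtain r where "A - {p, q} = {r}" by (auto simp: card_1_singleton_iff)
  then show thesis using that[of r] assms by auto
qed

locale critical_graph = pair_graph +
  assumes not_series_parallel: "\<not> series_parallel G"
    and ex_critical: "\<exists>s\<in>pverts G. series_parallel (G \<ominus> {s})"
    and critical: "v \<in> pverts G \<Longrightarrow> degree G v \<le> 3 \<Longrightarrow> series_parallel (G \<ominus> {v})"

locale reduced_critical_graph = critical_graph +
  assumes min_degree: "v \<in> pverts G \<Longrightarrow> 3 \<le> degree G v"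
begin

abbreviation cubic :: "'a \<Rightarrow> bool" where
  "cubic v \<equiv> degree G v = 3"

lemma cubic_in_verts: "cubic v \<Longrightarrow> v \<in> pverts G"
  using in_arcsD1 by (cases "nbrs G v = {}") auto

lemma obtain_nbr:
  assumes "v \<in> pverts G"
  obtains u where "(v, u) \<in> parcs G"
proof -
  have "nbrs G v \<noteq> {}" using min_degree[OF assms] by auto
  then show thesis using that by blast
qed

lemma series_parallel_delete_cubic: "cubic v \<Longrightarrow> series_parallel (G \<ominus> {v})"
  using critical cubic_in_verts by simp

lemma pair_graph_delete_eliminate: "pair_graph (G \<ominus> A \<oslash> b)"
  using pair_graph.pair_graph_eliminate_vert[OF pair_graph_delete_verts] .

lemma series_parallel_delete_eliminate:
  assumes "cubic s" "cubic b" "(s, b) \<in> parcs G"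
  shows "series_parallel (G \<ominus> {s} \<oslash> b)"
proof (rule series_parallel_eliminate)
  show "series_parallel (G \<ominus> {s})" using assms(1) by (rule series_parallel_delete_cubic)
  have "b \<noteq> s" using assms(3) loopfree by blast
  then show "b \<in> pverts (G \<ominus> {s})" "degree (G \<ominus> {s}) b \<le> 2"
    using assms cubic_in_verts by (auto simp: degree_delete_vert)
qed

lemma cubic_nbr_if_degree_delete_le_2:
  assumes "y \<in> pverts G" "y \<noteq> s" "degree (G \<ominus> {s}) y \<le> 2"
  shows "cubic y \<and> (s, y) \<in> parcs G"
  using min_degree[OF assms(1)] assms(2,3) by (auto simp: degree_delete_vert split: if_splits)

lemma cubic_nbr_or_closed_nbrs_mono:
  assumes "y \<in> pverts G" "y \<notin> {s, b}" "degree (G \<ominus> {s} \<oslash> b) y \<le> 2"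
  shows "cubic y \<and> (s, y) \<in> parcs G \<or> closed_nbrs (G \<ominus> {s}) b \<subseteq> closed_nbrs (G \<ominus> {s}) y"
proof (cases "degree (G \<ominus> {s}) y \<le> 2")
  case True
  then show ?thesis using cubic_nbr_if_degree_delete_le_2 assms by auto
next
  case False
  interpret Gs: pair_graph "G \<ominus> {s}" by (rule pair_graph_delete_verts)
  show ?thesis
    using False assms(2,3) by (intro disjI2 Gs.closed_nbrs_mono_if_degree_eliminate_less) auto
qed

lemma low_degree_vertex_after_elimination:
  assumes "cubic s" "cubic b" "(s, b) \<in> parcs G"
    and "u = v \<or> (u, v) \<in> parcs (G \<ominus> {s} \<oslash> b)" "\<not> pverts G \<subseteq> {s, b, u, v}"
  obtains y where "y \<in> pverts G" "y \<notin> {s, b, u, v}"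
    "cubic y \<and> (s, y) \<in> parcs G \<or> closed_nbrs (G \<ominus> {s}) b \<subseteq> closed_nbrs (G \<ominus> {s}) y"
proof -
  obtain y where "y \<in> pverts (G \<ominus> {s} \<oslash> b)" "y \<notin> {u, v}" "degree (G \<ominus> {s} \<oslash> b) y \<le> 2"
  proof (rule series_parallel_low_degree_outside_edge)
    show "series_parallel (G \<ominus> {s} \<oslash> b)" using assms(1-3) by (rule series_parallel_delete_eliminate)
    show "u = v \<or> (u, v) \<in> parcs (G \<ominus> {s} \<oslash> b)" by (rule assms(4))
    show "\<not> pverts (G \<ominus> {s} \<oslash> b) \<subseteq> {u, v}" using assms(5) by auto
  qed (rule pair_graph_delete_eliminate)
  then show thesis using that[of y] cubic_nbr_or_closed_nbrs_mono[of y s b] by auto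
qed

lemma low_degree_vertex_after_two_eliminations:
  fixes s b
  defines "H \<equiv> G \<ominus> {s} \<oslash> b"
  assumes "cubic s" "cubic b" "(s, b) \<in> parcs G"
    and "c \<in> pverts H" "degree H c \<le> 2"
    and "u = v \<or> (u, v) \<in> parcs (H \<oslash> c)" "\<not> pverts G \<subseteq> {s, b, c, u, v}"
  obtains y where "y \<in> pverts G" "y \<notin> {s, b, c, u, v}"
    "cubic y \<and> (s, y) \<in> parcs G \<or> closed_nbrs (G \<ominus> {s}) b \<subseteq> closed_nbrs (G \<ominus> {s}) y \<or>
      closed_nbrs H c \<subseteq> closed_nbrs H y"
proof -
  interpret H: pair_graph H unfolding H_def by (rule pair_graph_delete_eliminate)
  obtain y where y: "y \<in> pverts (H \<oslash> c)" "y \<notin> {u, v}" "degree (H \<oslash> c) y \<le> 2"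
  proof (rule series_parallel_low_degree_outside_edge)
    show "series_parallel (H \<oslash> c)"
      using series_parallel_delete_eliminate[OF assms(2-4)] assms(5,6)
      unfolding H_def by (rule series_parallel_eliminate)
    show "u = v \<or> (u, v) \<in> parcs (H \<oslash> c)" by (rule assms(7))
    show "\<not> pverts (H \<oslash> c) \<subseteq> {u, v}" using assms(8) by (auto simp: H_def)
  qed (rule H.pair_graph_eliminate_vert)
  have "degree H y \<le> 2 \<or> closed_nbrs H c \<subseteq> closed_nbrs H y"
    using H.closed_nbrs_mono_if_degree_eliminate_less[of y c] y by force
  then show thesis
    using that[of y] y cubic_nbr_or_closed_nbrs_mono[of y s b] by (auto simp: H_def)
qed

lemma at_most_one_noncubic_nbr:
  assumes "cubic s" "(s, p) \<in> parcs G" "(s, q) \<in> parcs G" "p \<noteq> q" "\<not> cubic p"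
  shows "cubic q"
proof -
  obtain r where r: "nbrs G s = {p, q, r}" "r \<noteq> p" "r \<noteq> q"
    using card_3_obtain_third[OF assms(1), of p q] assms by auto
  obtain y where "y \<in> pverts (G \<ominus> {s})" "y \<notin> {r, r}" "degree (G \<ominus> {s}) y \<le> 2"
  proof (rule series_parallel_low_degree_outside_edge)
    show "series_parallel (G \<ominus> {s})" using assms(1) by (rule series_parallel_delete_cubic)
    have "p \<in> pverts (G \<ominus> {s})" using assms(2) in_arcsD2 loopfree by auto
    then show "\<not> pverts (G \<ominus> {s}) \<subseteq> {r, r}" using r(2) by auto
  qed (use pair_graph_delete_verts in auto)
  then have "cubic y" "y \<in> nbrs G s - {r}"
    using cubic_nbr_if_degree_delete_le_2[of y s] by auto
  then show ?thesis using assms(5) r(1) by auto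
qed

lemma ex_cubic: "\<exists>v\<in>pverts G. cubic v"
proof -
  obtain s where s: "s \<in> pverts G" "series_parallel (G \<ominus> {s})" using ex_critical by blast
  obtain u where "(s, u) \<in> parcs G" using s(1) by (rule obtain_nbr)
  then have "\<not> pverts G \<subseteq> {s}" using in_arcsD2 loopfree by blast
  then obtain v where "v \<in> pverts G" "degree G v \<le> 3"
    using degree_le_3_if_series_parallel_delete[OF s(2)] by blast
  then show ?thesis using min_degree by force
qed

lemma ex_cubic_neq: "\<exists>v. v \<noteq> h \<and> cubic v"
proof -
  obtain s where s: "cubic s" using ex_cubic by blast
  obtain p q r where pqr: "nbrs G s = {p, q, r}" "p \<noteq> q" using s by (auto simp: card_3_iff)
  have "s \<notin> {p, q}" using loopfree pqr(1) by blast
  moreover have "cubic p \<or> cubic q" using at_most_one_noncubic_nbr[OF s, of p q] pqr by auto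
  ultimately show ?thesis using s by (cases "h = s") auto
qed

lemma connected_delete_vert: "Digraph_Component.connected (with_proj (G \<ominus> {h}))"
proof -
  interpret Gh: pair_graph "G \<ominus> {h}" by (rule pair_graph_delete_verts)
  obtain s where s: "s \<noteq> h" "cubic s" using ex_cubic_neq by blast
  interpret Gs: pair_graph "G \<ominus> {s}" by (rule pair_graph_delete_verts)
  have s_in: "s \<in> Y"
    if Y: "Y \<subseteq> pverts (G \<ominus> {h})" "Y \<noteq> {}" "parcs (G \<ominus> {h}) `` Y \<subseteq> Y" for Y
  proof (rule ccontr)
    assume "s \<notin> Y"
    have closed: "parcs G `` Y \<subseteq> insert h Y"
      using Y(1,3) unfolding Image_delete_verts by auto
    have "\<exists>y\<in>Y. degree (G \<ominus> {s}) y \<le> 2"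
    proof (rule series_parallel_attached_low_degree[OF _ Gs.pair_graph])
      show "series_parallel (G \<ominus> {s})" using s(2) by (rule series_parallel_delete_cubic)
      show "parcs (G \<ominus> {s}) `` Y \<subseteq> Y \<union> {h, h}"
        using closed unfolding Image_delete_verts by auto
    qed (use Y \<open>s \<notin> Y\<close> in auto)
    then obtain y where "y \<in> Y" "(s, y) \<in> parcs G"
      using cubic_nbr_if_degree_delete_le_2[of _ s] Y(1) \<open>s \<notin> Y\<close> by auto
    then have "s \<in> parcs G `` Y" using arcs_symmetric by blast
    then show False using closed s(1) \<open>s \<notin> Y\<close> by blast
  qed
  have "Z = pverts (G \<ominus> {h})"
    if Z: "Z \<subseteq> pverts (G \<ominus> {h})" "Z \<noteq> {}" "parcs (G \<ominus> {h}) `` Z \<subseteq> Z" for Z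
  proof (rule ccontr)
    assume "Z \<noteq> pverts (G \<ominus> {h})"
    moreover have "parcs (G \<ominus> {h}) `` (pverts (G \<ominus> {h}) - Z) \<subseteq> pverts (G \<ominus> {h}) - Z"
      using Z(3) Gh.arcs_symmetric Gh.in_arcsD2 by blast
    ultimately have "s \<in> pverts (G \<ominus> {h}) - Z" using Z(1) by (intro s_in) auto
    then show False using s_in[OF Z] by blast
  qed
  moreover have "pverts (G \<ominus> {h}) \<noteq> {}" using s cubic_in_verts by auto
  ultimately show ?thesis by (simp add: Gh.connected_iff_closed)
qed

lemma closed_eq_verts:
  assumes "Y \<subseteq> pverts G" "Y \<noteq> {}" "parcs G `` Y \<subseteq> Y"
  shows "Y = pverts G"
proof (rule ccontr)
  assume "Y \<noteq> pverts G"
  then obtain h where h: "h \<in> pverts G" "h \<notin> Y" using assms(1) by blast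
  interpret Gh: pair_graph "G \<ominus> {h}" by (rule pair_graph_delete_verts)
  have "Y \<subseteq> pverts (G \<ominus> {h})" "parcs (G \<ominus> {h}) `` Y \<subseteq> Y"
    using assms(1,3) h(2) by (auto simp: Image_delete_verts)
  then have "Y = pverts (G \<ominus> {h})"
    using connected_delete_vert[of h] assms(2) unfolding Gh.connected_iff_closed by blast
  moreover obtain y where "(h, y) \<in> parcs G" using h(1) by (rule obtain_nbr)
  then have "y \<in> pverts (G \<ominus> {h})" "h \<in> nbrs G y"
    using in_arcsD2 loopfree arcs_symmetric by auto
  ultimately show False using assms(3) h(2) by blast
qed

lemma wheel_if_hub:
  assumes "h \<in> pverts G" "nbrs G h = pverts G - {h}"
    and "\<And>v. v \<in> pverts G \<Longrightarrow> v \<noteq> h \<Longrightarrow> cubic v"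
  shows "\<exists>l. wheel l (with_proj G)"
proof -
  interpret Gh: pair_graph "G \<ominus> {h}" by (rule pair_graph_delete_verts)
  have "degree (G \<ominus> {h}) v = 2" if "v \<in> pverts (G \<ominus> {h})" for v
    using that assms by (auto simp: degree_delete_vert)
  then obtain l where "cycle_graph l (G \<ominus> {h})"
    using Gh.cycle_graph_if_connected connected_delete_vert by blast
  then show ?thesis using wheel_if_cycle_graph_delete_hub assms(1,2) by blast
qed

lemma wheel_if_card_4:
  assumes "card (pverts G) = 4"
  shows "\<exists>l. wheel l (with_proj G)"
proof -
  have nbrs: "nbrs G v = pverts G - {v}" if "v \<in> pverts G" for v
  proof (rule card_seteq)
    show "nbrs G v \<subseteq> pverts G - {v}" using nbrs_subset loopfree by blast
    show "card (pverts G - {v}) \<le> degree G v" using min_degree[OF that] assms that by simp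
  qed (use pair_finite_verts in simp)
  obtain h where "h \<in> pverts G" using ex_critical by blast
  then show ?thesis using assms by (intro wheel_if_hub[of h]) (auto simp: nbrs)
qed

lemma cubic_twins:
  assumes "nbrs G s = {b, a, c}" "nbrs G b = {s, a, c}" "a \<noteq> c"
  shows "pverts G = {s, b, a, c}"
proof (rule ccontr)
  assume neq: "pverts G \<noteq> {s, b, a, c}"
  note iffs = in_parcs_if_nbrs_eq[OF assms(1)] in_parcs_if_nbrs_eq[OF assms(2)]
  have distinct: "distinct [s, b, a, c]"
    using notin_if_nbrs_eq[OF assms(1)] notin_if_nbrs_eq[OF assms(2)] assms(3) by auto
  then have cubic: "cubic s" "cubic b" by (simp_all add: assms)
  have "{s, b, a, c} \<subseteq> pverts G"
    using nbrs_subset[of s] nbrs_subset[of b] assms(1,2) by auto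
  moreover have "(a, c) \<in> parcs (G \<ominus> {s} \<oslash> b)" using distinct iffs by auto
  moreover have "(s, b) \<in> parcs G" using iffs by simp
  ultimately obtain y where "y \<in> pverts G" "y \<notin> {s, b, a, c}"
    "cubic y \<and> (s, y) \<in> parcs G \<or> closed_nbrs (G \<ominus> {s}) b \<subseteq> closed_nbrs (G \<ominus> {s}) y"
    using low_degree_vertex_after_elimination[OF cubic, of a c] neq by blast
  then show False using iffs by auto
qed

lemma cubic_fan_extends:
  assumes "cubic s" "cubic b" "(s, c) \<in> parcs G" "\<not> cubic c"
    and "nbrs G b = {s, c, b'}" "b' \<noteq> s" "b' \<noteq> c"
  shows "cubic b' \<and> (b', c) \<in> parcs G"
proof -
  note b_iffs = in_parcs_if_nbrs_eq[OF assms(5)]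
  have neq: "s \<noteq> b" "s \<noteq> c" "b \<noteq> c" using assms(3) b_iffs loopfree by auto
  have "(s, b) \<in> parcs G" using b_iffs by simp
  obtain a where a: "nbrs G s = {b, c, a}" "a \<noteq> b" "a \<noteq> c"
    using card_3_obtain_third[OF assms(1), of b c] assms(3) b_iffs neq by auto
  note s_iffs = in_parcs_if_nbrs_eq[OF a(1)]
  have "c \<in> pverts G" using assms(3) by (rule in_arcsD2)
  then have "\<not> pverts G \<subseteq> {s, b, a, a}" using neq a(3) by blast
  then obtain y where y: "y \<in> pverts G" "y \<notin> {s, b, a, a}"
    "cubic y \<and> (s, y) \<in> parcs G \<or> closed_nbrs (G \<ominus> {s}) b \<subseteq> closed_nbrs (G \<ominus> {s}) y"
    by (rule low_degree_vertex_after_elimination[OF assms(1,2) \<open>(s, b) \<in> parcs G\<close> disjI1[OF refl]])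
  have "\<not> (cubic y \<and> (s, y) \<in> parcs G)" using y(2) s_iffs assms(4) by auto
  then have mono: "closed_nbrs (G \<ominus> {s}) b \<subseteq> closed_nbrs (G \<ominus> {s}) y" using y(3) by blast
  then have "y \<in> {c, b'}" using y(2) b_iffs by auto
  moreover have "{c, b'} \<subseteq> closed_nbrs G y" using mono b_iffs neq assms(6) by auto
  ultimately have "(b', c) \<in> parcs G" using assms(7) arcs_symmetric[of c b'] by auto
  moreover have "cubic b'"
    using b_iffs assms(2,4,7) by (intro at_most_one_noncubic_nbr[of b c b']) auto
  ultimately show ?thesis by blast
qed

lemma wheel_if_fan:
  assumes "cubic s" "cubic b" "(s, b) \<in> parcs G" "(s, h) \<in> parcs G" "(b, h) \<in> parcs G" "\<not> cubic h"
  shows "\<exists>l. wheel l (with_proj G)"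
proof -
  define X where
    "X = {v. cubic v \<and> (v, h) \<in> parcs G \<and> (\<exists>u. cubic u \<and> (u, h) \<in> parcs G \<and> (u, v) \<in> parcs G)}"
  interpret Gh: pair_graph "G \<ominus> {h}" by (rule pair_graph_delete_verts)
  have "b \<in> X" using assms by (auto simp: X_def)
  have "y \<in> X" if "v \<in> X" "(v, y) \<in> parcs G" "y \<noteq> h" for v y
  proof -
    obtain u where u: "cubic u" "(u, h) \<in> parcs G" "(u, v) \<in> parcs G"
      and v: "cubic v" "(v, h) \<in> parcs G"
      using \<open>v \<in> X\<close> by (auto simp: X_def)
    have "cubic y \<and> (y, h) \<in> parcs G"
    proof (cases "y = u")
      case False
      have "u \<noteq> h" "(v, u) \<in> parcs G" using u assms(6) arcs_symmetric by auto
      then have "nbrs G v = {u, h, y}"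
        using v False \<open>(v, y) \<in> parcs G\<close> \<open>y \<noteq> h\<close> by (intro nbrs_eqI) auto
      then show ?thesis using cubic_fan_extends[OF u(1) v(1) u(2) assms(6)] False \<open>y \<noteq> h\<close> by blast
    qed (use u in simp)
    then show ?thesis using v \<open>(v, y) \<in> parcs G\<close> by (auto simp: X_def)
  qed
  then have "parcs (G \<ominus> {h}) `` X \<subseteq> X" by auto
  moreover have "X \<subseteq> pverts (G \<ominus> {h})" using cubic_in_verts assms(6) by (auto simp: X_def)
  ultimately have "X = pverts (G \<ominus> {h})"
    using connected_delete_vert[of h] \<open>b \<in> X\<close> unfolding Gh.connected_iff_closed by blast
  then have X: "v \<in> pverts G \<Longrightarrow> v \<noteq> h \<Longrightarrow> cubic v \<and> (h, v) \<in> parcs G" for v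
    using arcs_symmetric by (auto simp: X_def)
  then have "nbrs G h = pverts G - {h}" using nbrs_subset loopfree by blast
  then show ?thesis using X in_arcsD2[OF assms(4)] by (intro wheel_if_hub[of h]) blast+
qed

lemma obtain_cubic_triangle_third_nbrs:
  assumes "cubic s" "cubic b" "cubic c" "(s, b) \<in> parcs G" "(s, c) \<in> parcs G" "(b, c) \<in> parcs G"
    and "card (pverts G) \<noteq> 4"
  obtains a b' c' where "nbrs G s = {b, c, a}" "nbrs G b = {s, c, b'}" "nbrs G c = {s, b, c'}"
    "distinct [s, b, c, a, b', c']"
proof -
  have neq: "s \<noteq> b" "s \<noteq> c" "b \<noteq> c" using assms(4-6) loopfree by auto
  have adj: "(b, s) \<in> parcs G" "(c, s) \<in> parcs G" "(c, b) \<in> parcs G"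
    using assms(4-6) arcs_symmetric by blast+
  obtain a where a: "nbrs G s = {b, c, a}" "a \<noteq> b" "a \<noteq> c"
    using card_3_obtain_third[OF assms(1), of b c] assms(4,5) neq by auto
  obtain b' where b': "nbrs G b = {s, c, b'}" "b' \<noteq> s" "b' \<noteq> c"
    using card_3_obtain_third[OF assms(2), of s c] assms(6) adj neq by auto
  obtain c' where c': "nbrs G c = {s, b, c'}" "c' \<noteq> s" "c' \<noteq> b"
    using card_3_obtain_third[OF assms(3), of s b] adj neq by auto
  have no_twins: False if "nbrs G p = {q, r, t}" "nbrs G q = {p, r, t}" "r \<noteq> t" for p q r t
  proof -
    have "pverts G = {p, q, r, t}" using that by (rule cubic_twins)
    moreover have "distinct [p, q, r, t]" using that loopfree by auto
    ultimately show False using assms(7) by simp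
  qed
  have "a \<noteq> b'" using no_twins[of s b c a] a b' by auto
  moreover have "a \<noteq> c'" using no_twins[of s c b a] a c' by (auto simp: insert_commute)
  moreover have "b' \<noteq> c'" using no_twins[of b c s b'] b' c' by auto
  moreover have "a \<noteq> s" "b' \<noteq> b" "c' \<noteq> c" using a(1) b'(1) c'(1) loopfree by blast+
  ultimately show thesis using that a b' c' neq by auto
qed

context
  fixes s b c a b' c'
  assumes cubic: "cubic s" "cubic b"
    and nbrs: "nbrs G s = {b, c, a}" "nbrs G b = {s, c, b'}" "nbrs G c = {s, b, c'}"
    and distinct: "distinct [s, b, c, a, b', c']"
begin

lemmas cubic_triangle_parcs_iffs =
  in_parcs_if_nbrs_eq[OF nbrs(1)] in_parcs_if_nbrs_eq[OF nbrs(2)] in_parcs_if_nbrs_eq[OF nbrs(3)]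

lemma cubic_triangle_nbrs_eliminate: "nbrs (G \<ominus> {s} \<oslash> b) c = {b', c'}"
  using distinct cubic_triangle_parcs_iffs by auto

lemma low_degree_vertex_after_cubic_triangle:
  assumes "u = v \<or> (u, v) \<in> parcs (G \<ominus> {s} \<oslash> b \<oslash> c)" "\<not> pverts G \<subseteq> {s, b, c, u, v}"
  obtains y where "y \<in> pverts G" "y \<notin> {s, b, c, u, v}"
    "cubic y \<and> (s, y) \<in> parcs G \<or> closed_nbrs (G \<ominus> {s}) b \<subseteq> closed_nbrs (G \<ominus> {s}) y \<or>
      closed_nbrs (G \<ominus> {s} \<oslash> b) c \<subseteq> closed_nbrs (G \<ominus> {s} \<oslash> b) y"
proof (rule low_degree_vertex_after_two_eliminations[OF cubic _ _ _ assms])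
  show "(s, b) \<in> parcs G" using cubic_triangle_parcs_iffs by simp
  have "(s, c) \<in> parcs G" using cubic_triangle_parcs_iffs by simp
  then show "c \<in> pverts (G \<ominus> {s} \<oslash> b)" using in_arcsD2 distinct by auto
  show "degree (G \<ominus> {s} \<oslash> b) c \<le> 2"
    by (simp add: cubic_triangle_nbrs_eliminate card_insert_if)
qed (rule that)

lemma cubic_triangle_third_nbr_cubic: "cubic a"
proof -
  note iffs = cubic_triangle_parcs_iffs
  have "(b', c') \<in> parcs (G \<ominus> {s} \<oslash> b \<oslash> c)" using distinct iffs by auto
  moreover have "(s, a) \<in> parcs G" using iffs by simp
  then have "\<not> pverts G \<subseteq> {s, b, c, b', c'}" using in_arcsD2 distinct by auto
  ultimately obtain y where y: "y \<in> pverts G" "y \<notin> {s, b, c, b', c'}"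
    "cubic y \<and> (s, y) \<in> parcs G \<or> closed_nbrs (G \<ominus> {s}) b \<subseteq> closed_nbrs (G \<ominus> {s}) y \<or>
      closed_nbrs (G \<ominus> {s} \<oslash> b) c \<subseteq> closed_nbrs (G \<ominus> {s} \<oslash> b) y"
    by (rule low_degree_vertex_after_cubic_triangle[OF disjI2])
  have "b \<notin> closed_nbrs (G \<ominus> {s}) y" "c \<notin> closed_nbrs (G \<ominus> {s} \<oslash> b) y"
    using y(2) iffs by auto
  then have "cubic y \<and> (s, y) \<in> parcs G" using y(3) by blast
  then show ?thesis using y(2) iffs by auto
qed

lemma cubic_triangle_third_nbrs_adj: "(b', c') \<in> parcs G"
proof -
  note iffs = cubic_triangle_parcs_iffs
  define H where "H = G \<ominus> {s} \<oslash> b"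
  have "(b, b') \<in> parcs G" using iffs by simp
  then have "\<not> pverts G \<subseteq> {s, b, c, a, a}" using in_arcsD2 distinct by auto
  then obtain y where y: "y \<in> pverts G" "y \<notin> {s, b, c, a, a}"
    "cubic y \<and> (s, y) \<in> parcs G \<or> closed_nbrs (G \<ominus> {s}) b \<subseteq> closed_nbrs (G \<ominus> {s}) y \<or>
      closed_nbrs H c \<subseteq> closed_nbrs H y"
    unfolding H_def by (rule low_degree_vertex_after_cubic_triangle[OF disjI1[OF refl]])
  have "(s, y) \<notin> parcs G" using y(2) iffs by simp
  moreover have "\<not> closed_nbrs (G \<ominus> {s}) b \<subseteq> closed_nbrs (G \<ominus> {s}) y"
  proof
    assume mono: "closed_nbrs (G \<ominus> {s}) b \<subseteq> closed_nbrs (G \<ominus> {s}) y"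
    then have "y = b'" using y(2) iffs by auto
    moreover have "(y, c) \<in> parcs G" using mono y(2) iffs distinct by auto
    ultimately show False using iffs distinct by auto
  qed
  ultimately have mono: "closed_nbrs H c \<subseteq> closed_nbrs H y" using y(3) by blast
  then have "y \<in> {b', c'}" using y(2) iffs by (auto simp: H_def)
  moreover have "{b', c'} \<subseteq> closed_nbrs H y"
    using mono cubic_triangle_nbrs_eliminate by (auto simp: H_def)
  ultimately have "(b', c') \<in> parcs H"
    using distinct parcs_commute[of b' c'] iffs by (auto simp: H_def)
  then show ?thesis using iffs distinct by (auto simp: H_def)
qed

end

lemma prism_if_cubic_triangle:
  assumes "cubic s" "cubic b" "cubic c" "(s, b) \<in> parcs G" "(s, c) \<in> parcs G" "(b, c) \<in> parcs G"
    and "card (pverts G) \<noteq> 4"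
  shows "prism (with_proj G)"
proof -
  obtain a b' c'
    where nbrs: "nbrs G s = {b, c, a}" "nbrs G b = {s, c, b'}" "nbrs G c = {s, b, c'}"
      and distinct: "distinct [s, b, c, a, b', c']"
    using obtain_cubic_triangle_third_nbrs[OF assms] .
  have swapped: "nbrs G s = {c, b, a}" "nbrs G b = {c, s, b'}" "nbrs G c = {b, s, c'}"
    using nbrs by auto
  note third = cubic_triangle_third_nbr_cubic cubic_triangle_third_nbrs_adj
  have a: "cubic a" "(b', c') \<in> parcs G" using third[OF assms(1,2) nbrs distinct] .
  have b': "cubic b'" "(a, c') \<in> parcs G"
    using third[OF assms(2,1) nbrs(2,1) swapped(3)] distinct by auto
  have c': "cubic c'" "(a, b') \<in> parcs G"
    using third[OF assms(3,1) nbrs(3) swapped(1,2)] distinct by auto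
  have "(s, a) \<in> parcs G" "(b, b') \<in> parcs G" "(c, c') \<in> parcs G" using nbrs by auto
  then have third_nbrs: "nbrs G a = {s, b', c'}" "nbrs G b' = {b, a, c'}" "nbrs G c' = {c, a, b'}"
    using a b' c' distinct arcs_symmetric by (intro nbrs_eqI; simp)+
  have verts: "{s, b, c, a, b', c'} = pverts G"
  proof (rule closed_eq_verts)
    show "{s, b, c, a, b', c'} \<subseteq> pverts G"
      using assms(1-3) a(1) b'(1) c'(1) cubic_in_verts by simp
    show "parcs G `` {s, b, c, a, b', c'} \<subseteq> {s, b, c, a, b', c'}"
      by (subst Image_eq_UN) (simp add: nbrs third_nbrs)
  qed simp
  show ?thesis
    by (rule prism_if_nbrs_eq[OF distinct verts[symmetric] nbrs])
      (simp_all add: third_nbrs insert_commute)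
qed

end

locale cubic_triangle_free_graph = reduced_critical_graph +
  assumes triangle_free:
    "cubic u \<Longrightarrow> (u, v) \<in> parcs G \<Longrightarrow> (u, w) \<in> parcs G \<Longrightarrow> (v, w) \<notin> parcs G"
begin

lemma not_closed_nbrs_delete_mono:
  assumes "cubic a" "(a, s) \<in> parcs G" "y \<notin> {a, s}"
  shows "\<not> closed_nbrs (G \<ominus> {s}) a \<subseteq> closed_nbrs (G \<ominus> {s}) y"
proof
  assume mono: "closed_nbrs (G \<ominus> {s}) a \<subseteq> closed_nbrs (G \<ominus> {s}) y"
  have "s \<noteq> a" using assms(2) loopfree by blast
  then have "(a, y) \<in> parcs G" using mono assms(3) arcs_symmetric by auto
  then obtain z where z: "nbrs G a = {s, y, z}" "z \<noteq> s" "z \<noteq> y"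
    using card_3_obtain_third[OF assms(1), of s y] assms(2,3) by auto
  then have "(a, z) \<in> parcs G" by auto
  then have "z \<in> closed_nbrs (G \<ominus> {s}) a" using z(2) \<open>s \<noteq> a\<close> by auto
  then have "(y, z) \<in> parcs G" using mono z(3) by auto
  then show False
    using triangle_free[OF assms(1) \<open>(a, y) \<in> parcs G\<close> \<open>(a, z) \<in> parcs G\<close>] by blast
qed

lemma cubic_nbr_of_adjacent_cubics:
  assumes "cubic s" "cubic a" "(s, a) \<in> parcs G" "(a, p) \<in> parcs G"
  shows "cubic p"
proof (cases "p = s")
  case False
  have as: "(a, s) \<in> parcs G" using assms(3) by (rule arcs_symmetric)
  obtain q where a: "nbrs G a = {s, p, q}" "q \<noteq> p"
    using card_3_obtain_third[OF assms(2), of s p] assms(4) as False by auto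
  have "\<not> pverts G \<subseteq> {a, s, q, q}"
    using in_arcsD2[OF assms(4)] notin_if_nbrs_eq[OF a(1)] a(2) False by auto
  then obtain y where "y \<in> pverts G" "y \<notin> {a, s, q, q}"
    "cubic y \<and> (a, y) \<in> parcs G \<or> closed_nbrs (G \<ominus> {a}) s \<subseteq> closed_nbrs (G \<ominus> {a}) y"
    by (rule low_degree_vertex_after_elimination[OF assms(2,1) as disjI1[OF refl]])
  then have "cubic y \<and> y \<in> nbrs G a - {s, q}"
    using not_closed_nbrs_delete_mono[OF assms(1,3), of y] by blast
  then show ?thesis using a(1) by auto
qed (use assms(1) in simp)

lemma all_cubic: "v \<in> pverts G \<Longrightarrow> cubic v"
proof -
  define X where "X = {v. cubic v \<and> (\<exists>u. cubic u \<and> (u, v) \<in> parcs G)}"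
  obtain s where s: "cubic s" using ex_cubic by blast
  then obtain a b c where abc: "nbrs G s = {a, b, c}" "a \<noteq> b" by (auto simp: card_3_iff)
  then have adj: "(s, a) \<in> parcs G" "(s, b) \<in> parcs G" by auto
  have "X = pverts G"
  proof (rule closed_eq_verts)
    show "X \<subseteq> pverts G" using cubic_in_verts by (auto simp: X_def)
    have "cubic a \<or> cubic b" using at_most_one_noncubic_nbr[OF s adj abc(2)] by blast
    then show "X \<noteq> {}" using s adj unfolding X_def by blast
    show "parcs G `` X \<subseteq> X"
      using cubic_nbr_of_adjacent_cubics unfolding X_def by blast
  qed
  then show "v \<in> pverts G \<Longrightarrow> cubic v" by (auto simp: X_def)
qed

lemma closed_nbrs_eliminate_mono_if_common_nbr:
  assumes "(s, a) \<in> parcs G" "(s, b) \<in> parcs G" "a \<noteq> b"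
  obtains y where "y \<notin> {s, a, b}"
    "closed_nbrs (G \<ominus> {s} \<oslash> a) b \<subseteq> closed_nbrs (G \<ominus> {s} \<oslash> a) y"
proof -
  have cubic: "cubic s" "cubic a" "cubic b" using assms in_arcsD1 in_arcsD2 all_cubic by blast+
  obtain c where s: "nbrs G s = {a, b, c}"
    using card_3_obtain_third[OF cubic(1), of a b] assms by auto
  note s_iffs = in_parcs_if_nbrs_eq[OF s]
  have nadj: "(b, a) \<notin> parcs G" "nbrs G a \<inter> {a, b, c} = {}"
    using triangle_free[OF cubic(1)] s_iffs by auto
  define H where "H = G \<ominus> {s} \<oslash> a"
  have "b \<in> pverts H"
    using cubic(3) cubic_in_verts notin_if_nbrs_eq[OF s] assms(3) by (auto simp: H_def)
  moreover have "nbrs H b \<subseteq> nbrs G b - {s}" using nadj(1) by (auto simp: H_def)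
  then have "degree H b \<le> card (nbrs G b - {s})" by (intro card_mono) auto
  then have "degree H b \<le> 2" using cubic(3) s_iffs by simp
  moreover have "\<not> pverts G \<subseteq> {s, a, b, c, c}"
  proof
    assume "pverts G \<subseteq> {s, a, b, c, c}"
    then have "nbrs G a \<subseteq> {s}" using nbrs_subset[of a] nadj(2) by blast
    then have "degree G a \<le> card {s}" by (intro card_mono) auto
    then show False using cubic(2) by simp
  qed
  ultimately obtain y where y: "y \<in> pverts G" "y \<notin> {s, a, b, c, c}"
    "cubic y \<and> (s, y) \<in> parcs G \<or> closed_nbrs (G \<ominus> {s}) a \<subseteq> closed_nbrs (G \<ominus> {s}) y \<or>
      closed_nbrs H b \<subseteq> closed_nbrs H y"
    unfolding H_def
    by (rule low_degree_vertex_after_two_eliminations[OF cubic(1,2) assms(1) _ _ disjI1[OF refl]])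
  then have "closed_nbrs H b \<subseteq> closed_nbrs H y"
    using not_closed_nbrs_delete_mono[OF cubic(2) arcs_symmetric[OF assms(1)], of y] s_iffs by blast
  then show thesis using that[of y] y(2) by (simp add: H_def)
qed

lemma nbrs_eq_if_common_nbr:
  assumes "(s, a) \<in> parcs G" "(s, b) \<in> parcs G"
  shows "nbrs G b = nbrs G a"
proof (cases "a = b")
  case False
  have cubic: "cubic s" "cubic a" "cubic b" using assms in_arcsD1 in_arcsD2 all_cubic by blast+
  have adj: "(a, s) \<in> parcs G" "(b, s) \<in> parcs G" "s \<noteq> b" "(b, a) \<notin> parcs G"
    using assms arcs_symmetric loopfree triangle_free[OF cubic(1)] by blast+
  define H where "H = G \<ominus> {s} \<oslash> a"
  obtain y where y: "y \<notin> {s, a, b}" "closed_nbrs H b \<subseteq> closed_nbrs H y"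
    using closed_nbrs_eliminate_mono_if_common_nbr[OF assms False] unfolding H_def .
  then have b_y: "(b, y) \<in> parcs G"
    using adj(4) parcs_commute[of y b] parcs_commute[of a b] by (auto simp: H_def)
  obtain z where z: "nbrs G b = {s, y, z}" "z \<noteq> s" "z \<noteq> y"
    using card_3_obtain_third[OF cubic(3), of s y] adj(2) b_y y(1) by auto
  then have b_z: "(b, z) \<in> parcs G" by auto
  then have "z \<in> closed_nbrs H b" using z(2) adj(3,4) False by (auto simp: H_def)
  then have "(y, z) \<in> parcs H" using y(2) z(3) by auto
  then have "(y, a) \<in> parcs G" "(a, z) \<in> parcs G"
    using triangle_free[OF cubic(3) b_y b_z] by (auto simp: H_def)
  then have "nbrs G a = {s, y, z}"
    using z adj(1) cubic(2) y(1) arcs_symmetric[of y a] by (intro nbrs_eqI) auto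
  then show ?thesis using z(1) by simp
qed simp

lemma complete_bipartite: "complete_bipartite_digraph 3 3 (with_proj G)"
proof -
  obtain s where s: "s \<in> pverts G" "cubic s" using ex_cubic by blast
  then obtain a where sa: "(s, a) \<in> parcs G" using obtain_nbr by blast
  have a: "cubic a" using sa in_arcsD2 all_cubic by blast
  define U W where "U = nbrs G a" and "W = nbrs G s"
  have W: "nbrs G w = U" if "w \<in> W" for w
    using nbrs_eq_if_common_nbr[of s a w] sa that by (simp add: U_def W_def)
  have U: "nbrs G u = W" if "u \<in> U" for u
    using nbrs_eq_if_common_nbr[of a s u] sa that arcs_symmetric by (simp add: U_def W_def)
  have "U \<inter> W = {}" using U loopfree by blast
  moreover have "U \<union> W = pverts G"
  proof (rule closed_eq_verts)
    show "U \<union> W \<subseteq> pverts G" using nbrs_subset by (simp add: U_def W_def)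
    show "U \<union> W \<noteq> {}" using sa by (auto simp: W_def)
    show "parcs G `` (U \<union> W) \<subseteq> U \<union> W" using U W by blast
  qed
  ultimately have "complete_bipartite_digraph (card U) (card W) (with_proj G)"
    using U W by (intro complete_bipartite_digraphI) auto
  then show ?thesis using s(2) a by (simp add: U_def W_def)
qed

end

lemma (in reduced_critical_graph) wheel_prism_or_K33: "wheel_prism_or_K33 G"
proof (cases "\<exists>u v w. cubic u \<and> (u, v) \<in> parcs G \<and> (u, w) \<in> parcs G \<and> (v, w) \<in> parcs G")
  case True
  then obtain u v w where
    uvw: "cubic u" "(u, v) \<in> parcs G" "(u, w) \<in> parcs G" "(v, w) \<in> parcs G" by blast
  then have "v \<noteq> w" using loopfree by blast
  then have "cubic v \<or> cubic w" using at_most_one_noncubic_nbr[OF uvw(1-3)] by blast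
  then obtain b c where "cubic b" "(u, b) \<in> parcs G" "(u, c) \<in> parcs G" "(b, c) \<in> parcs G"
    using uvw arcs_symmetric by blast
  then show ?thesis
    using wheel_if_card_4 wheel_if_fan[OF uvw(1)] prism_if_cubic_triangle[OF uvw(1)] by blast
next
  case False
  then interpret cubic_triangle_free_graph G by unfold_locales blast
  show ?thesis using complete_bipartite by blast
qed

section \<open>Suppressing vertices of low degree\<close>

lemma (in pair_graph) subdivision_pair_if_eliminate_vert:
  assumes "nbrs G w = {x, y}" "x \<noteq> y" "(x, y) \<notin> parcs G"
    and "subdivision_pair P (G \<oslash> w)"
  shows "subdivision_pair P G"
proof -
  note iffs = in_parcs_if_nbrs_eq[OF assms(1)]
  have neq: "x \<noteq> w" "y \<noteq> w" using notin_if_nbrs_eq[OF assms(1)] by auto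
  have "(w, x) \<in> parcs G" using iffs by simp
  then have "w \<in> pverts G" by (rule in_arcsD1)
  have nadj: "(y, x) \<notin> parcs G" using assms(3) arcs_symmetric by blast
  have "subdivide (G \<oslash> w) (x, y) w = G"
  proof (rule pair_pre_digraph_eqI)
    show "pverts (subdivide (G \<oslash> w) (x, y) w) = pverts G" using \<open>w \<in> pverts G\<close> by auto
    fix p q
    consider "p = w" | "q = w" | "p \<noteq> w" "q \<noteq> w" by blast
    then show "(p, q) \<in> parcs (subdivide (G \<oslash> w) (x, y) w) \<longleftrightarrow> (p, q) \<in> parcs G"
      using neq iffs nadj assms(3) loopfree by cases auto
  qed
  moreover have "(x, y) \<in> parcs (G \<oslash> w)" using neq iffs assms(2) by simp
  ultimately show ?thesis
    using subdivision_pair_divide[of "(x, y)" "G \<oslash> w" w P] assms(4) by simp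
qed

context critical_graph
begin

context
  fixes w
  assumes low_degree: "w \<in> pverts G" "degree G w \<le> 2"
    and not_series_parallel_eliminate: "\<not> series_parallel (G \<oslash> w)"
begin

lemma low_degree_nonadjacent_nbrs:
  obtains x y where "nbrs G w = {x, y}" "x \<noteq> y" "(x, y) \<notin> parcs G"
proof -
  have "G \<oslash> w \<noteq> G \<ominus> {w}"
    using critical[OF low_degree(1)] low_degree(2) not_series_parallel_eliminate by auto
  then obtain x y where xy: "(w, x) \<in> parcs G" "(w, y) \<in> parcs G" "x \<noteq> y" "(x, y) \<notin> parcs G"
    using pair_pre_digraph_eqI[of "G \<oslash> w" "G \<ominus> {w}"] loopfree parcs_commute by auto
  then have "nbrs G w = {x, y}" using low_degree(2) by (intro nbrs_eqI) auto
  then show thesis using that xy(3,4) by blast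
qed

lemma degree_eliminate_low_degree:
  assumes "v \<noteq> w"
  shows "degree G v \<le> degree (G \<oslash> w) v"
proof (rule ccontr)
  assume "\<not> degree G v \<le> degree (G \<oslash> w) v"
  then have "closed_nbrs G w \<subseteq> closed_nbrs G v"
    using closed_nbrs_mono_if_degree_eliminate_less[OF assms] by simp
  moreover obtain x y where xy: "nbrs G w = {x, y}" "x \<noteq> y" "(x, y) \<notin> parcs G"
    by (rule low_degree_nonadjacent_nbrs)
  ultimately have "v \<in> {x, y}" "{x, y} \<subseteq> closed_nbrs G v"
    using assms in_parcs_if_nbrs_eq[OF xy(1)] by auto
  then show False using xy(2,3) arcs_symmetric[of y x] by auto
qed

lemma critical_graph_eliminate: "critical_graph (G \<oslash> w)"
proof -
  interpret Gw: pair_graph "G \<oslash> w" by (rule pair_graph_eliminate_vert)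
  have critical_eliminate: "series_parallel (G \<oslash> w \<ominus> {v})"
    if "v \<in> pverts G - {w}" "degree G v \<le> 3" for v
  proof -
    have "series_parallel (G \<ominus> {v})" using that critical by blast
    moreover have "degree (G \<ominus> {v}) w \<le> 2"
      using that low_degree(2) by (auto simp: degree_delete_vert)
    ultimately have "series_parallel (G \<ominus> {v} \<oslash> w)"
      using that low_degree(1) by (intro series_parallel_eliminate) auto
    then show ?thesis using that eliminate_delete_commute[of w "{v}" G] by auto
  qed
  show ?thesis
  proof
    show "\<not> series_parallel (G \<oslash> w)" by (rule not_series_parallel_eliminate)
    show "series_parallel (G \<oslash> w \<ominus> {v})" if "v \<in> pverts (G \<oslash> w)" "degree (G \<oslash> w) v \<le> 3" for v
      using that degree_eliminate_low_degree[of v] by (intro critical_eliminate) auto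
    obtain x y where "nbrs G w = {x, y}" "x \<noteq> y" "(x, y) \<notin> parcs G"
      by (rule low_degree_nonadjacent_nbrs)
    then have "\<not> pverts G \<subseteq> {w}" using nbrs_subset[of w] notin_if_nbrs_eq[of w] by blast
    moreover have "series_parallel (G \<ominus> {w})" using critical low_degree by simp
    ultimately obtain v where "v \<in> pverts G - {w}" "degree G v \<le> 3"
      using degree_le_3_if_series_parallel_delete by blast
    then show "\<exists>v\<in>pverts (G \<oslash> w). series_parallel (G \<oslash> w \<ominus> {v})"
      using critical_eliminate by auto
  qed
qed

end

end

lemma subdivision_if_critical_graph:
  assumes "critical_graph G"
  shows "\<exists>P. subdivision_pair P G \<and> wheel_prism_or_K33 P"
  using assms
proof (induction "card (pverts G)" arbitrary: G rule: less_induct)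
  case less
  interpret critical_graph G by fact
  show ?case
  proof (cases "\<exists>w\<in>pverts G. degree G w \<le> 2 \<and> \<not> series_parallel (G \<oslash> w)")
    case True
    then obtain w where w: "w \<in> pverts G" "degree G w \<le> 2" "\<not> series_parallel (G \<oslash> w)" by blast
    have "card (pverts (G \<oslash> w)) < card (pverts G)"
      using card_Diff1_less[OF pair_finite_verts w(1)] by simp
    then obtain P where "subdivision_pair P (G \<oslash> w)" "wheel_prism_or_K33 P"
      using less.hyps critical_graph_eliminate[OF w] by blast
    moreover obtain x y where "nbrs G w = {x, y}" "x \<noteq> y" "(x, y) \<notin> parcs G"
      using w by (rule low_degree_nonadjacent_nbrs)
    ultimately show ?thesis using subdivision_pair_if_eliminate_vert by blast
  next
    case False
    interpret reduced_critical_graph G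
    proof
      fix v assume "v \<in> pverts G"
      then show "3 \<le> degree G v"
        using False not_series_parallel series_parallel.eliminations[of G] by force
    qed
    have "pair_bidirected_digraph G" by unfold_locales
    then show ?thesis
      using wheel_prism_or_K33 subdivision_pair_base by blast
  qed
qed

section \<open>Maximal connected sets with critical complement\<close>

context pair_graph
begin

context
  assumes connected: "Digraph_Component.connected (with_proj G)"
    and degree_ge_4: "\<And>v. v \<in> pverts G \<Longrightarrow> 4 \<le> degree G v"
begin

lemma critical_graph_delete_verts:
  assumes "A \<subseteq> pverts G" "A \<noteq> {}" "\<not> series_parallel (G \<ominus> A)"
    and series_parallel_insert: "\<And>u v. u \<in> A \<Longrightarrow> v \<notin> A \<Longrightarrow> (u, v) \<in> parcs G \<Longrightarrow>
      series_parallel (G \<ominus> insert v A)"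
  shows "critical_graph (G \<ominus> A)"
proof -
  interpret H: pair_graph "G \<ominus> A" by (rule pair_graph_delete_verts)
  have critical: "series_parallel (G \<ominus> A \<ominus> {v})" if "u \<in> A" "v \<notin> A" "(u, v) \<in> parcs G" for u v
    using series_parallel_insert[OF that] by (simp add: delete_delete_verts)
  show ?thesis
  proof
    show "\<not> series_parallel (G \<ominus> A)" by (rule assms(3))
    show "series_parallel (G \<ominus> A \<ominus> {v})"
      if v: "v \<in> pverts (G \<ominus> A)" "degree (G \<ominus> A) v \<le> 3" for v
    proof -
      have "nbrs (G \<ominus> A) v \<noteq> nbrs G v" using v degree_ge_4[of v] by auto
      then obtain u where "u \<in> A" "(v, u) \<in> parcs G" using v(1) by auto
      then show ?thesis using critical[of u v] v(1) arcs_symmetric by simp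
    qed
    have "A \<noteq> pverts G" using assms(3) series_parallel.eliminations[of "G \<ominus> A"] by auto
    then have "\<not> parcs G `` A \<subseteq> A"
      using connected assms(1,2) unfolding connected_iff_closed by blast
    then obtain u v where "u \<in> A" "v \<notin> A" "(u, v) \<in> parcs G" by blast
    then show "\<exists>v\<in>pverts (G \<ominus> A). series_parallel (G \<ominus> A \<ominus> {v})"
      using critical in_arcsD2 by (intro bexI[of _ v]) auto
  qed
qed

lemma ex_connected_set_with_critical_complement:
  assumes "x \<in> pverts G"
  shows "\<exists>A\<subseteq>pverts G. x \<in> A \<and> Digraph_Component.connected (with_proj G \<restriction> A) \<and>
    critical_graph (G \<ominus> A)"
proof -
  define \<A> where "\<A> = {A. A \<subseteq> pverts G \<and> x \<in> A \<and>
    Digraph_Component.connected (with_proj G \<restriction> A) \<and> \<not> series_parallel (G \<ominus> A)}"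
  have "{x} \<in> \<A>"
  proof -
    have "nbrs G x \<noteq> {}" using degree_ge_4[OF assms] by auto
    then have "\<not> pverts G \<subseteq> {x}" using in_arcsD2 loopfree by blast
    then have "\<not> series_parallel (G \<ominus> {x})"
      using degree_le_3_if_series_parallel_delete degree_ge_4 by fastforce
    moreover have "Digraph_Component.connected (with_proj G \<restriction> {x})"
      using assms by (subst connected_induce_iff_closed) auto
    ultimately show ?thesis using assms by (simp add: \<A>_def)
  qed
  moreover have "finite \<A>"
    using pair_finite_verts by (auto simp: \<A>_def intro: finite_subset[of _ "Pow (pverts G)"])
  ultimately obtain A where "A \<in> \<A>" and maximal: "\<forall>B\<in>\<A>. A \<subseteq> B \<longrightarrow> A = B"
    using finite_has_maximal2[of \<A> "{x}"] by metis
  then have A: "A \<subseteq> pverts G" "x \<in> A" "Digraph_Component.connected (with_proj G \<restriction> A)"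
    "\<not> series_parallel (G \<ominus> A)" by (simp_all add: \<A>_def)
  have "series_parallel (G \<ominus> insert v A)" if "u \<in> A" "v \<notin> A" "(u, v) \<in> parcs G" for u v
  proof (rule ccontr)
    assume "\<not> series_parallel (G \<ominus> insert v A)"
    moreover have "Digraph_Component.connected (with_proj G \<restriction> insert v A)"
      using A(1,3) that(1,3) by (rule connected_induce_insert)
    ultimately have "insert v A \<in> \<A>" using A(1,2) that(3) in_arcsD2 by (simp add: \<A>_def)
    then show False using maximal that(2) by auto
  qed
  then have "critical_graph (G \<ominus> A)" using A by (intro critical_graph_delete_verts) auto
  then show ?thesis using A by blast
qed

end

end

theorem theorem6:
  fixes G :: "'a pair_pre_digraph" and x :: 'a
  assumes "pair_graph G"
    and "Digraph_Component.connected (with_proj G)"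
    and "\<forall>v \<in> pverts G. 4 \<le> out_degree (with_proj G) v"
    and "x \<in> pverts G"
  shows "\<exists>H P :: 'a pair_pre_digraph.
      induced_subgraph (with_proj H) (with_proj G) \<and>
      subdivision_pair P H \<and>
      ((\<exists>l. wheel l (with_proj P)) \<or> prism (with_proj P) \<or>
        complete_bipartite_digraph 3 3 (with_proj P)) \<and>
      Digraph_Component.connected (with_proj G \<restriction> (pverts G - pverts H)) \<and>
      x \<in> pverts G - pverts H"
proof -
  interpret pair_graph G by fact
  have "4 \<le> degree G v" if "v \<in> pverts G" for v
    using that assms(3) by (simp add: out_degree_with_proj)
  then obtain A where A: "A \<subseteq> pverts G" "x \<in> A"
    "Digraph_Component.connected (with_proj G \<restriction> A)" "critical_graph (G \<ominus> A)"
    using ex_connected_set_with_critical_complement[OF assms(2) _ assms(4)] by blast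
  obtain P where "subdivision_pair P (G \<ominus> A)" "wheel_prism_or_K33 P"
    using subdivision_if_critical_graph[OF A(4)] by blast
  moreover have "induced_subgraph (with_proj (G \<ominus> A)) (with_proj G)"
    unfolding with_proj_delete_verts by (rule induced_induce) simp
  moreover have "pverts G - pverts (G \<ominus> A) = A" using A(1) by auto
  ultimately show ?thesis using A(2,3) by metis
qed

end
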